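(* Let $X$ be a complex Banach space and let $f\in\mathcal{C}_u(\mathbb{B}_X,X)$. Then the following statements are equivalent: (i) $v(f) = \|f\|$. (ii) $f\parallel Id$, i.e. there is $\lambda\in\mathbb{T}$ with $\|f+\lambda\, Id\| = \|f\|+\|Id\|$, where $Id:\mathbb{B}_X\to X$ is the identity function $Id(x)=x$, regarded as an element of $\mathcal{C}_u(\mathbb{B}_X,X)$.
   Context: $\mathbb{T}=\{\lambda\in\mathbb{C}:|\lambda|=1\}$. $\mathbb{B}_X$ and $\mathbb{S}_X$ are the closed unit ball and the unit sphere of $X$, and $X^*$ is the topological dual of $X$. $\mathcal{C}_u(\mathbb{B}_X,X)$ is the space of all uniformly continuous functions $\mathbb{B}_X\to X$ (these are automatically bounded), with the supremum norm $\|f\|=\sup_{x\in\mathbb{B}_X}\|f(x)\|$. The numerical radius of a bounded function $f:\mathbb{B}_X\to X$ is $$v(f)=\sup\{|x^*(f(x))| : x\in \mathbb{S}_X,\ x^*\in X^*,\ \|x^*\|=x^*(x)=1\}.$$ A supremum over the empty set is taken to be $0$ (relevant only if $X=\{0\}$). In a normed space, $x\parallel y$ (norm-parallel) means $\|x+\lambda y\|=\|x\|+\|y\|$ for some $\lambda\in\mathbb{T}$. *)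

theory Defs
  imports "HOL-Analysis.Analysis"
begin

class scaleC =
  fixes scaleC :: "complex \<Rightarrow> 'a \<Rightarrow> 'a" (infixr "*\<^sub>C" 75)

text \<open>The distribution has no complex normed spaces.  A complex normed space is presented as a
  real one whose real scaling is the restriction of a complex scaling, so that the topology and the
  norm are the library's.\<close>

class complex_normed_vector = real_normed_vector + scaleC +
  assumes scaleC_add_right: "a *\<^sub>C (x + y) = a *\<^sub>C x + a *\<^sub>C y"
    and scaleC_add_left: "(a + b) *\<^sub>C x = a *\<^sub>C x + b *\<^sub>C x"
    and scaleC_scaleC: "a *\<^sub>C (b *\<^sub>C x) = (a * b) *\<^sub>C x"
    and scaleC_one: "1 *\<^sub>C x = x"
    and scaleR_scaleC: "r *\<^sub>R x = complex_of_real r *\<^sub>C x"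
    and norm_scaleC: "norm (a *\<^sub>C x) = cmod a * norm x"

class complex_banach = complex_normed_vector + banach

instantiation complex :: complex_banach
begin

definition scaleC_complex :: "complex \<Rightarrow> complex \<Rightarrow> complex"
  where "scaleC_complex a x = a * x"

instance
  by standard (auto simp: scaleC_complex_def algebra_simps norm_mult scaleR_conv_of_real)

end

text \<open>Real-linear bounded maps into the complex numbers carry the operator norm, and this is the
  dual norm on the complex-linear ones.\<close>

definition cdual :: "('a::complex_normed_vector \<Rightarrow>\<^sub>L complex) set"
  where "cdual = {\<phi>. \<forall>c x. blinfun_apply \<phi> (c *\<^sub>C x) = c * blinfun_apply \<phi> x}"

text \<open>A function on the closed unit ball is represented by a function on the whole type; the
  notions below depend only on its values on the ball.\<close>

definition Cu :: "('a::complex_normed_vector \<Rightarrow> 'a) set"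
  where "Cu = {f. uniformly_continuous_on (cball 0 1) f}"

definition Cu_norm :: "('a::complex_normed_vector \<Rightarrow> 'a) \<Rightarrow> real"
  where "Cu_norm f = (SUP x\<in>cball 0 1. norm (f x))"

text \<open>By the following fact the supremum above is over a nonempty bounded set whenever
  \<open>f \<in> Cu\<close>.\<close>

lemma Cu_bounded:
  fixes f :: "'a::complex_normed_vector \<Rightarrow> 'a"
  assumes "f \<in> Cu"
  shows "bounded (f ` cball 0 1)"
proof -
  obtain d where d: "d > 0"
    and ud: "\<And>x y. x \<in> cball 0 1 \<Longrightarrow> y \<in> cball 0 1 \<Longrightarrow> dist y x < d \<Longrightarrow> dist (f y) (f x) < 1"
  proof -
    have "\<exists>d>0. \<forall>x\<in>cball 0 1. \<forall>y\<in>cball 0 1. dist y x < d \<longrightarrow> dist (f y) (f x) < 1"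
      using assms unfolding Cu_def uniformly_continuous_on_def by simp
    then show thesis using that by blast
  qed
  obtain n where n: "inverse (real (Suc n)) < d"
    using reals_Archimedean[OF d] by blast
  define a where "a = inverse (real (Suc n))"
  have a: "0 < a" "a < d" "real (Suc n) * a = 1"
    using n by (simp_all add: a_def)
  have "norm (f x) \<le> norm (f 0) + real (Suc n)" if x: "x \<in> cball 0 1" for x
  proof -
    define p where "p k = (real k * a) *\<^sub>R x" for k
    have nx: "norm x \<le> 1" using x by simp
    have ball: "p j \<in> cball 0 1" if "j \<le> Suc n" for j
    proof -
      have "real j * a \<le> real (Suc n) * a"
        using that a(1) by (intro mult_right_mono) auto
      then have "real j * a \<le> 1" unfolding a(3) .
      then have "real j * a * norm x \<le> 1 * 1"
        by (rule mult_mono) (use nx in auto)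
      then show ?thesis using a(1) by (simp add: p_def)
    qed
    have near: "dist (p (Suc k)) (p k) < d" for k
    proof -
      have "p (Suc k) - p k = a *\<^sub>R x"
        unfolding p_def scaleR_left_diff_distrib[symmetric] by (simp add: algebra_simps)
      then have "dist (p (Suc k)) (p k) = a * norm x"
        using a(1) by (simp add: dist_norm)
      also have "\<dots> \<le> a * 1"
        using a(1) nx by (intro mult_left_mono) auto
      finally show ?thesis using a(2) by linarith
    qed
    have "norm (f (p k)) \<le> norm (f 0) + real k" if "k \<le> Suc n" for k
      using that
    proof (induction k)
      case 0
      then show ?case by (simp add: p_def)
    next
      case (Suc k)
      have "dist (f (p (Suc k))) (f (p k)) < 1"
        using Suc.prems by (intro ud ball near) auto
      moreover have "norm (f (p (Suc k))) \<le> norm (f (p k)) + norm (f (p (Suc k)) - f (p k))"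
        by (rule norm_triangle_sub)
      moreover have "norm (f (p k)) \<le> norm (f 0) + real k"
        using Suc by simp
      moreover have "real (Suc k) = real k + 1" by simp
      ultimately show ?case unfolding dist_norm by linarith
    qed
    from this[of "Suc n"] show ?thesis using a(3) by (simp add: p_def)
  qed
  then show ?thesis unfolding bounded_iff by blast
qed

text \<open>The supremum of the empty set is unspecified on the reals, hence the case distinction.\<close>

definition numerical_radius :: "('a::complex_normed_vector \<Rightarrow> 'a) \<Rightarrow> real"
  where "numerical_radius f =
    (let V = {cmod (blinfun_apply \<phi> (f x)) | x \<phi>.
                x \<in> sphere 0 1 \<and> \<phi> \<in> cdual \<and> norm \<phi> = 1 \<and> blinfun_apply \<phi> x = 1}
     in if V = {} then 0 else Sup V)"

definition Cu_parallel ::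
    "('a::complex_normed_vector \<Rightarrow> 'a) \<Rightarrow> ('a \<Rightarrow> 'a) \<Rightarrow> bool"  (infix "\<parallel>\<^sub>u" 50)
  where "f \<parallel>\<^sub>u g \<longleftrightarrow>
    (\<exists>\<mu>\<in>sphere 0 1. Cu_norm (\<lambda>x. f x + \<mu> *\<^sub>C g x) = Cu_norm f + Cu_norm g)"

end

theory Submission
  imports Defs
begin

text \<open>If \<open>v(f) = \<parallel>f\<parallel>\<close>, a point \<open>z\<close> of modulus \<open>\<parallel>f\<parallel>\<close> lies in the closure of the numerical range,
  and \<open>\<lambda> = z / \<bar>z\<bar>\<close> makes \<open>f\<close> parallel to the identity.  Conversely, if
  \<open>\<parallel>f + \<lambda> Id\<parallel> = \<parallel>f\<parallel> + 1\<close>, choose \<open>x\<close> in the ball where this norm is almost attained and a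
  functional \<open>\<phi>\<close> norming \<open>\<lambda>\<^sup>-\<^sup>1 f(x) + x\<close>; then \<open>\<phi>(x)\<close> is almost \<open>1\<close> and \<open>\<phi>(\<lambda>\<^sup>-\<^sup>1 f(x))\<close> is almost
  \<open>\<parallel>f\<parallel>\<close>.  The Bishop-Phelps-Bollobas theorem moves \<open>(x, \<phi>)\<close> slightly to a pair \<open>(y, \<psi>)\<close> with
  \<open>\<psi>(y) = 1\<close>, and uniform continuity of \<open>f\<close> shows that \<open>\<psi>(f(y))\<close> is still almost \<open>\<parallel>f\<parallel>\<close> in modulus.
  Functionals are produced by a Hahn-Banach sandwich theorem on a convex cone, which rests on the
  fact that a minimal sublinear functional is linear.\<close>

section \<open>Sublinear functionals\<close>

definition sublinear :: "('a::real_vector \<Rightarrow> real) \<Rightarrow> bool"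
  where "sublinear p \<longleftrightarrow>
    (\<forall>x y. p (x + y) \<le> p x + p y) \<and> (\<forall>t\<ge>0. \<forall>x. p (t *\<^sub>R x) = t * p x)"

lemma sublinear_add: "sublinear p \<Longrightarrow> p (x + y) \<le> p x + p y"
  and sublinear_scaleR: "sublinear p \<Longrightarrow> t \<ge> 0 \<Longrightarrow> p (t *\<^sub>R x) = t * p x"
  by (auto simp: sublinear_def)

lemma sublinear_zero: "sublinear p \<Longrightarrow> p 0 = 0"
  using sublinear_scaleR[of p 0 0] by simp

lemma sublinear_ge: "sublinear p \<Longrightarrow> - p (- x) \<le> p x"
  using sublinear_add[of p x "- x"] sublinear_zero[of p] by simp

text \<open>Applying \<open>scale\<close> to \<open>inverse t\<close> and
  \<open>t *\<^sub>R x\<close> reverses the inequality, which gives homogeneity.\<close>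

lemma sublinearI:
  assumes add: "\<And>x y. p (x + y) \<le> p x + p y"
    and zero: "p 0 = 0"
    and scale: "\<And>t x. t > 0 \<Longrightarrow> p (t *\<^sub>R x) \<le> t * p x"
  shows "sublinear p"
  unfolding sublinear_def
proof (intro conjI allI impI)
  show "p (t *\<^sub>R x) = t * p x" if "0 \<le> t" for t x
  proof (cases "t = 0")
    case False
    then have t: "t > 0" using that by simp
    have "p x \<le> inverse t * p (t *\<^sub>R x)"
      using scale[of "inverse t" "t *\<^sub>R x"] t by simp
    then have "t * p x \<le> p (t *\<^sub>R x)"
      using t by (simp add: field_simps)
    then show ?thesis using scale[OF t, of x] by simp
  qed (simp add: zero)
qed (rule add)

lemma convex_cone_ray: "convex_cone (conic hull {a})"
  by (simp add: convex_cone_def convex_conic_hull conic_conic_hull conic_hull_eq_empty)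

text \<open>The functional \<open>q\<close> is the infimum of \<open>p (w + c) - g c\<close> over
  \<open>c\<close> in the cone: \<open>c = 0\<close> gives \<open>q \<le> p\<close>, and
  \<open>w = - x\<close>, \<open>c = x\<close> gives the bound on \<open>- x\<close>. A linear
  functional below \<open>q\<close> therefore lies above \<open>g\<close> on
  \<open>K\<close>.\<close>

lemma sublinear_below_on_cone:
  fixes p g :: "'a::real_vector \<Rightarrow> real"
  assumes p: "sublinear p" and K: "convex_cone K"
    and g_add: "\<And>x y. x \<in> K \<Longrightarrow> y \<in> K \<Longrightarrow> g x + g y \<le> g (x + y)"
    and g_scale: "\<And>t x. t \<ge> 0 \<Longrightarrow> x \<in> K \<Longrightarrow> g (t *\<^sub>R x) = t * g x"
    and g_le: "\<And>x. x \<in> K \<Longrightarrow> g x \<le> p x"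
  obtains q where "sublinear q" "\<And>x. q x \<le> p x" "\<And>x. x \<in> K \<Longrightarrow> q (- x) \<le> - g x"
proof -
  define q where "q w = (INF c\<in>K. p (w + c) - g c)" for w
  have zero: "0 \<in> K" and ne: "K \<noteq> {}"
    using K by (auto simp: convex_cone_contains_0 convex_cone_nonempty)
  have g0: "g 0 = 0" using g_scale[of 0 0] zero by simp
  \<comment> \<open>From \<open>g c \<le> p c \<le> p (w + c) + p (- w)\<close>: this is where
    \<open>g \<le> p\<close> makes the infimum finite.\<close>
  have lb: "- p (- w) \<le> p (w + c) - g c" if "c \<in> K" for w c
    using sublinear_add[OF p, of "w + c" "- w"] g_le[OF that] by simp
  have le: "q w \<le> p (w + c) - g c" if "c \<in> K" for w c
    unfolding q_def by (intro cINF_lower[OF _ that] bdd_belowI2) (rule lb)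
  have ge: "m \<le> q w" if "\<And>c. c \<in> K \<Longrightarrow> m \<le> p (w + c) - g c" for m w
    unfolding q_def by (rule cINF_greatest[OF ne that])
  have "sublinear q"
  proof (rule sublinearI)
    fix u v
    have "q (u + v) \<le> (p (u + c) - g c) + (p (v + d) - g d)" if "c \<in> K" "d \<in> K" for c d
    proof -
      have "q (u + v) \<le> p (u + v + (c + d)) - g (c + d)"
        by (intro le convex_cone_add K that)
      also have "p (u + v + (c + d)) \<le> p (u + c) + p (v + d)"
        using sublinear_add[OF p, of "u + c" "v + d"] by (simp add: algebra_simps)
      finally show ?thesis using g_add[OF that] by simp
    qed
    \<comment> \<open>The two infima are taken one after the other, with the remaining term moved to
      the left.\<close>
    then have "q (u + v) - (p (u + c) - g c) \<le> q v" if "c \<in> K" for c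
      using that by (intro ge) (smt (verit))
    then have "q (u + v) - q v \<le> q u"
      by (intro ge) (smt (verit))
    then show "q (u + v) \<le> q u + q v" by simp
  next
    have "q 0 \<le> 0" using le[OF zero, of 0] sublinear_zero[OF p] g0 by simp
    moreover have "0 \<le> q 0" by (intro ge) (use g_le in simp)
    ultimately show "q 0 = 0" by simp
  next
    fix t :: real and x assume t: "t > 0"
    have "q (t *\<^sub>R x) / t \<le> q x"
    proof (rule ge)
      fix c assume c: "c \<in> K"
      have "q (t *\<^sub>R x) \<le> p (t *\<^sub>R x + t *\<^sub>R c) - g (t *\<^sub>R c)"
        using t c by (intro le convex_cone_scaleR K) auto
      also have "\<dots> = t * (p (x + c) - g c)"
        using t c sublinear_scaleR[OF p, of t "x + c"] g_scale[of t c]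
        by (simp add: algebra_simps)
      finally show "q (t *\<^sub>R x) / t \<le> p (x + c) - g c"
        using t by (simp add: field_simps)
    qed
    then show "q (t *\<^sub>R x) \<le> t * q x" using t by (simp add: field_simps)
  qed
  moreover have "q x \<le> p x" for x using le[OF zero, of x] g0 by simp
  moreover have "q (- x) \<le> - g x" if "x \<in> K" for x
    using le[OF that, of "- x"] sublinear_zero[OF p] by simp
  ultimately show thesis using that by blast
qed

text \<open>The pointwise infimum works: \<open>- p (- x)\<close> bounds every member from below at
  \<open>x\<close>, and for subadditivity the smaller of two members of the chain serves both
  summands.\<close>

lemma sublinear_INF_chain:
  fixes p :: "'a::real_vector \<Rightarrow> real"
  assumes C: "C \<noteq> {}" "\<And>q. q \<in> C \<Longrightarrow> sublinear q"
    and p: "\<And>q x. q \<in> C \<Longrightarrow> q x \<le> p x"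
    and chain: "\<And>q r. q \<in> C \<Longrightarrow> r \<in> C \<Longrightarrow> q \<le> r \<or> r \<le> q"
  obtains u where "sublinear u" "\<And>q. q \<in> C \<Longrightarrow> u \<le> q"
proof -
  define u where "u x = (INF q\<in>C. q x)" for x
  have lb: "- p (- x) \<le> q x" if "q \<in> C" for q x
    using sublinear_ge[OF C(2)[OF that], of x] p[OF that, of "- x"] by simp
  have le: "u x \<le> q x" if "q \<in> C" for q x
    unfolding u_def by (intro cINF_lower[OF _ that] bdd_belowI2) (rule lb)
  have ge: "m \<le> u x" if "\<And>q. q \<in> C \<Longrightarrow> m \<le> q x" for m x
    unfolding u_def by (rule cINF_greatest[OF C(1) that])
  have "sublinear u"
  proof (rule sublinearI)
    fix x y
    have "u (x + y) \<le> q x + r y" if qr: "q \<in> C" "r \<in> C" for q r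
    proof -
      obtain s where s: "s \<in> C" "s \<le> q" "s \<le> r" using chain[OF qr] qr by blast
      have "u (x + y) \<le> s x + s y"
        using le[OF s(1), of "x + y"] sublinear_add[OF C(2)[OF s(1)], of x y] by linarith
      then show ?thesis using le_funD[OF s(2), of x] le_funD[OF s(3), of y] by linarith
    qed
    then have "u (x + y) - q x \<le> u y" if "q \<in> C" for q
      using that by (intro ge) (smt (verit))
    then have "u (x + y) - u y \<le> u x"
      by (intro ge) (smt (verit))
    then show "u (x + y) \<le> u x + u y" by simp
  next
    show "u 0 = 0"
      unfolding u_def using C by (simp add: sublinear_zero)
  next
    fix t :: real and x assume t: "t > 0"
    have "u (t *\<^sub>R x) / t \<le> u x"
    proof (rule ge)
      fix q assume q: "q \<in> C"
      show "u (t *\<^sub>R x) / t \<le> q x"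
        using le[OF q, of "t *\<^sub>R x"] sublinear_scaleR[OF C(2)[OF q], of t x] t
        by (simp add: field_simps)
    qed
    then show "u (t *\<^sub>R x) \<le> t * u x" using t by (simp add: field_simps)
  qed
  then show thesis using le by (intro that) (auto simp: le_fun_def)
qed

text \<open>On the ray through \<open>a\<close>, \<open>m\<close> itself is additive, so
  \<open>sublinear_below_on_cone\<close> applies with \<open>g = m\<close>. Minimality forces
  \<open>q = m\<close>, hence \<open>m (- a) \<le> - m a\<close>. So \<open>m\<close> is odd, and an
  odd sublinear functional is linear.\<close>

lemma minimal_sublinear_linear:
  fixes m :: "'a::real_vector \<Rightarrow> real"
  assumes m: "sublinear m" and min: "\<And>q. sublinear q \<Longrightarrow> q \<le> m \<Longrightarrow> q = m"
  shows "linear m"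
proof -
  have neg: "m (- a) = - m a" for a
  proof -
    have ray: "x \<in> conic hull {a} \<longleftrightarrow> (\<exists>t\<ge>0. x = t *\<^sub>R a)" for x
      by (auto simp: conic_hull_explicit)
    obtain q where q: "sublinear q" "\<And>x. q x \<le> m x"
        "\<And>x. x \<in> conic hull {a} \<Longrightarrow> q (- x) \<le> - m x"
    proof (rule sublinear_below_on_cone[OF m convex_cone_ray, of a m])
      fix x y assume "x \<in> conic hull {a}" "y \<in> conic hull {a}"
      then obtain s t where "s \<ge> 0" "t \<ge> 0" "x = s *\<^sub>R a" "y = t *\<^sub>R a" by (auto simp: ray)
      then show "m x + m y \<le> m (x + y)"
        using m sublinear_scaleR[OF m, of "s + t" a]
        by (simp add: sublinear_scaleR algebra_simps)
    qed (use m in \<open>auto simp: sublinear_scaleR\<close>)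
    have "q = m" using min q(1,2) by (simp add: le_fun_def)
    moreover have "a \<in> conic hull {a}" unfolding ray by (intro exI[of _ 1]) simp
    ultimately have "m (- a) \<le> - m a" using q(3) by blast
    then show ?thesis using sublinear_ge[OF m, of a] by linarith
  qed
  show ?thesis
  proof (rule linearI)
    fix x y
    have "m x \<le> m (x + y) + m (- y)" using sublinear_add[OF m, of "x + y" "- y"] by simp
    then show "m (x + y) = m x + m y"
      using sublinear_add[OF m, of x y] neg[of y] by linarith
  next
    fix t :: real and x
    show "m (t *\<^sub>R x) = t *\<^sub>R m x"
    proof (cases "t \<ge> 0")
      case True
      then show ?thesis using sublinear_scaleR[OF m] by simp
    next
      case False
      then have "m (- t *\<^sub>R x) = - t * m x" by (intro sublinear_scaleR m) simp
      then show ?thesis using neg[of "t *\<^sub>R x"] by simp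
    qed
  qed
qed

lemma linear_below_sublinear:
  fixes p :: "'a::real_vector \<Rightarrow> real"
  assumes p: "sublinear p"
  obtains h where "linear h" "\<And>x. h x \<le> p x"
proof -
  define A where "A = {q. sublinear q \<and> q \<le> p}"
  have "\<exists>m\<in>A. \<forall>a\<in>A. a \<le> m \<longrightarrow> a = m"
  \<comment> \<open>Zorn yields maximal elements, so the order is reversed. The empty chain is
    bounded by \<open>p\<close>, since the infimum over no functionals is unspecified.\<close>
  proof (rule predicate_Zorn)
    show "partial_order_on A (relation_of (\<lambda>x y. y \<le> x) A)"
      by (auto simp: partial_order_on_def preorder_on_def relation_of_def refl_on_def
          intro!: transI antisymI)
  next
    fix C assume "C \<in> Chains (relation_of (\<lambda>x y. y \<le> x) A)"
    then have CA: "C \<subseteq> A" and chain: "\<And>q r. q \<in> C \<Longrightarrow> r \<in> C \<Longrightarrow> q \<le> r \<or> r \<le> q"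
      by (auto simp: Chains_def relation_of_def)
    show "\<exists>u\<in>A. \<forall>a\<in>C. u \<le> a"
    proof (cases "C = {}")
      case True
      then show ?thesis using p by (auto simp: A_def)
    next
      case False
      then obtain u where u: "sublinear u" "\<And>q. q \<in> C \<Longrightarrow> u \<le> q"
        by (rule sublinear_INF_chain[of C p]) (use CA chain in \<open>auto simp: A_def le_fun_def\<close>)
      moreover have "u \<le> p"
        using False u(2) CA by (auto simp: A_def intro: order_trans)
      ultimately show ?thesis by (auto simp: A_def)
    qed
  qed
  then obtain m where m: "m \<in> A" and min: "\<And>a. a \<in> A \<Longrightarrow> a \<le> m \<Longrightarrow> a = m" by blast
  have "linear m"
    by (rule minimal_sublinear_linear) (use m min in \<open>auto simp: A_def intro: order_trans\<close>)
  then show thesis using m by (intro that) (auto simp: A_def le_fun_def)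
qed

theorem Hahn_Banach_sandwich:
  fixes p g :: "'a::real_vector \<Rightarrow> real"
  assumes "sublinear p" and "convex_cone K"
    and "\<And>x y. x \<in> K \<Longrightarrow> y \<in> K \<Longrightarrow> g x + g y \<le> g (x + y)"
    and "\<And>t x. t \<ge> 0 \<Longrightarrow> x \<in> K \<Longrightarrow> g (t *\<^sub>R x) = t * g x"
    and "\<And>x. x \<in> K \<Longrightarrow> g x \<le> p x"
  obtains h where "linear h" "\<And>x. h x \<le> p x" "\<And>x. x \<in> K \<Longrightarrow> g x \<le> h x"
proof -
  obtain q where q: "sublinear q" "\<And>x. q x \<le> p x" "\<And>x. x \<in> K \<Longrightarrow> q (- x) \<le> - g x"
    using sublinear_below_on_cone[OF assms] by blast
  obtain h where h: "linear h" "\<And>x. h x \<le> q x" using linear_below_sublinear[OF q(1)] by blast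
  show thesis
  proof (rule that[OF h(1)])
    show "h x \<le> p x" for x using h(2)[of x] q(2)[of x] by linarith
    show "g x \<le> h x" if "x \<in> K" for x
      using h(2)[of "- x"] q(3)[OF that] linear_neg[OF h(1), of x] by linarith
  qed
qed

section \<open>Real functionals dominated by the norm\<close>

lemma sublinear_norm: "k \<ge> 0 \<Longrightarrow> sublinear (\<lambda>x::'a::real_normed_vector. k * norm x)"
  unfolding sublinear_def by (auto simp: distrib_left[symmetric] intro: mult_left_mono norm_triangle_ineq)

lemma abs_linear_le_norm:
  fixes h :: "'a::real_normed_vector \<Rightarrow> real"
  assumes "linear h" "\<And>x. h x \<le> k * norm x"
  shows "\<bar>h x\<bar> \<le> k * norm x"
  using assms(2)[of x] assms(2)[of "- x"] linear_neg[OF assms(1), of x] by (simp add: abs_le_iff)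

text \<open>The norm is additive on the ray through \<open>a\<close>, so it can serve as both the
  lower bound on that cone and the global upper bound of the sandwich.\<close>

lemma norming_functional:
  fixes a :: "'a::real_normed_vector"
  obtains h where "linear h" "\<And>x. h x \<le> norm x" "h a = norm a"
proof -
  obtain h where h: "linear h" "\<And>x. h x \<le> 1 * norm x" "\<And>x. x \<in> conic hull {a} \<Longrightarrow> norm x \<le> h x"
    by (rule Hahn_Banach_sandwich[OF sublinear_norm[of 1] convex_cone_ray, of a norm])
      (auto simp: conic_hull_explicit scaleR_add_left[symmetric] distrib_right)
  have "a \<in> conic hull {a}" by (simp add: hull_inc)
  then have "h a = norm a" using h(2)[of a] h(3)[of a] by simp
  then show thesis using h that by simp
qed

section \<open>The Bishop-Phelps-Bollobas theorem\<close>

text \<open>\<open>T w\<close> collects the points whose gain in \<open>F\<close> over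
  \<open>w\<close> pays for their distance at rate \<open>k\<close>. Choosing nearly best points in
  successive sets \<open>T (w n)\<close> makes \<open>F (w n)\<close> increase to a limit, and the
  gains control the distances, so \<open>w\<close> is Cauchy. Its limit is the required
  point.\<close>

lemma Ekeland:
  fixes F :: "'a::metric_space \<Rightarrow> real"
  assumes S: "complete S" and F: "continuous_on S F" "bdd_above (F ` S)" and k: "k > 0" and x: "x \<in> S"
  obtains y where "y \<in> S" "k * dist x y \<le> F y - F x" "\<And>z. z \<in> S \<Longrightarrow> F z - F y \<le> k * dist y z"
proof -
  define T where "T w = {z \<in> S. k * dist w z \<le> F z - F w}" for w
  have T_self: "w \<in> T w" if "w \<in> S" for w using that by (simp add: T_def)
  have T_trans: "b \<in> T a \<Longrightarrow> c \<in> T b \<Longrightarrow> c \<in> T a" for a b c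
    using mult_left_mono[OF dist_triangle[of a c b], of k] k
    by (auto simp: T_def distrib_left)
  have step: "\<exists>v\<in>T w. \<forall>z\<in>T w. F z \<le> F v + (1/2) ^ n" if "w \<in> S" for w and n :: nat
  proof -
    have bdd: "bdd_above (F ` T w)" by (rule bdd_above_mono[OF F(2)]) (auto simp: T_def)
    have "(SUP z\<in>T w. F z) - (1/2) ^ n < (SUP z\<in>T w. F z)" by simp
    then obtain v where "v \<in> T w" "(SUP z\<in>T w. F z) - (1/2) ^ n < F v"
      using less_cSUP_iff[OF _ bdd] T_self[OF \<open>w \<in> S\<close>] by blast
    then show ?thesis
      using cSUP_upper[OF _ bdd] by (intro bexI[of _ v] ballI) (smt (verit))+
  qed
  obtain w where w: "w n \<in> S" "w 0 = x" "w (Suc n) \<in> T (w n)"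
      "\<And>z. z \<in> T (w n) \<Longrightarrow> F z \<le> F (w (Suc n)) + (1/2) ^ n" for n :: nat
  proof -
    have "\<exists>w. \<forall>n. (w n \<in> S \<and> (n = 0 \<longrightarrow> w n = x)) \<and>
        (w (Suc n) \<in> T (w n) \<and> (\<forall>z\<in>T (w n). F z \<le> F (w (Suc n)) + (1/2) ^ n))"
    proof (rule dependent_nat_choice)
      fix v and n :: nat assume "v \<in> S \<and> (n = 0 \<longrightarrow> v = x)"
      then show "\<exists>u. (u \<in> S \<and> (Suc n = 0 \<longrightarrow> u = x)) \<and> u \<in> T v \<and> (\<forall>z\<in>T v. F z \<le> F u + (1/2) ^ n)"
        using step[of v n] by (auto simp: T_def)
    qed (use x in auto)
    then show thesis using that by blast
  qed
  have wT: "w m \<in> T (w n)" if "n \<le> m" for n m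
    using that by (induction m rule: dec_induct) (use T_self w T_trans in blast)+
  have inc: "incseq (\<lambda>n. F (w n))"
  proof (rule incseq_SucI)
    show "F (w n) \<le> F (w (Suc n))" for n
      using w(3)[of n] mult_nonneg_nonneg[OF less_imp_le[OF k] zero_le_dist, of "w n" "w (Suc n)"]
      by (simp add: T_def del: mult_nonneg_nonneg)
  qed
  obtain B where B: "\<And>z. z \<in> S \<Longrightarrow> F z \<le> B" using F(2) by (auto simp: bdd_above_def)
  have "convergent (\<lambda>n. F (w n))"
    using incseq_convergent[OF inc, of B] B w(1) unfolding convergent_def by metis
  then have cF: "Cauchy (\<lambda>n. F (w n))" by (rule convergent_Cauchy)
  have "Cauchy w"
  proof (rule CauchyI')
    fix e :: real assume "e > 0"
    then obtain M where M: "\<And>m n. m \<ge> M \<Longrightarrow> n \<ge> M \<Longrightarrow> dist (F (w m)) (F (w n)) < k * e"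
      using metric_CauchyD[OF cF, of "k * e"] k by auto
    have "dist (w m) (w n) < e" if "m \<ge> M" "n > m" for m n
    proof -
      have "k * dist (w m) (w n) \<le> F (w n) - F (w m)"
        using wT[of m n] that by (simp add: T_def)
      also have "\<dots> < k * e" using M[of m n] that by (simp add: dist_real_def)
      finally show ?thesis using k by simp
    qed
    then show "\<exists>M. \<forall>m\<ge>M. \<forall>n>m. dist (w m) (w n) < e" by blast
  qed
  then obtain y where y: "y \<in> S" "w \<longlonglongrightarrow> y"
    using S w(1) by (auto simp: complete_def)
  have Fy: "(\<lambda>n. F (w n)) \<longlonglongrightarrow> F y"
    using F(1) y w(1) unfolding continuous_on_sequentially by (auto simp: comp_def)
  have yT: "y \<in> T (w n)" for n
  proof -
    have "k * dist (w n) y \<le> F y - F (w n)"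
    proof (rule LIMSEQ_le)
      show "(\<lambda>m. k * dist (w n) (w m)) \<longlonglongrightarrow> k * dist (w n) y"
        by (intro tendsto_intros y)
      show "(\<lambda>m. F (w m) - F (w n)) \<longlonglongrightarrow> F y - F (w n)"
        by (intro tendsto_intros Fy)
      show "\<exists>N. \<forall>m\<ge>N. k * dist (w n) (w m) \<le> F (w m) - F (w n)"
        using wT by (auto simp: T_def)
    qed
    then show ?thesis using y by (simp add: T_def)
  qed
  show thesis
  proof (rule that[OF y(1)])
    show "k * dist x y \<le> F y - F x" using yT[of 0] w(2) by (simp add: T_def)
    fix z assume z: "z \<in> S"
    show "F z - F y \<le> k * dist y z"
    proof (rule ccontr)
      assume *: "\<not> F z - F y \<le> k * dist y z"
      \<comment> \<open>Such a \<open>z\<close> lies in every \<open>T (w n)\<close>, so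
        near-optimality of \<open>w (Suc n)\<close> gives \<open>F z \<le> F y\<close> in the limit,
        while the negated inequality says that \<open>F z\<close> exceeds
        \<open>F y\<close>.\<close>
      then have "z \<in> T y" using z by (simp add: T_def)
      then have "F z \<le> F (w (Suc n)) + (1/2) ^ n" for n
        using w(4) T_trans yT by blast
      moreover have "(\<lambda>n. F (w (Suc n)) + (1/2) ^ n) \<longlonglongrightarrow> F y + 0"
        by (intro tendsto_add LIMSEQ_Suc Fy LIMSEQ_power_zero) simp
      ultimately have "F z \<le> F y + 0"
        by (intro LIMSEQ_le_const) auto
      then show False using * k by (smt (verit) mult_nonneg_nonneg zero_le_dist)
    qed
  qed
qed

text \<open>Ekeland's principle for \<open>\<phi>\<close> on the ball with rate \<open>k\<close>
  yields \<open>y\<close>; the possible gain is at most \<open>k\<^sup>2\<close>, so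
  \<open>y\<close> is within \<open>k\<close> of \<open>x\<close>. A correction \<open>h\<close> of
  size \<open>k\<close> makes \<open>\<phi> - h\<close> support the ball at \<open>y\<close>, and
  normalising it costs at most \<open>2 * k\<close> more.\<close>

theorem Bishop_Phelps_Bollobas:
  fixes x :: "'a::banach" and \<phi> :: "'a \<Rightarrow> real"
  assumes x: "x \<in> cball 0 1" and \<phi>: "linear \<phi>" "\<And>w. \<phi> w \<le> norm w"
    and k: "0 < k" "k \<le> 1/2" and \<phi>x: "1 - k\<^sup>2 \<le> \<phi> x"
  obtains y \<psi> where "norm y = 1" "linear \<psi>" "\<And>w. \<psi> w \<le> norm w" "\<psi> y = 1"
    "dist x y \<le> k" "\<And>w. \<bar>\<phi> w - \<psi> w\<bar> \<le> 3 * k * norm w"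
proof -
  have \<phi>_abs: "\<bar>\<phi> w\<bar> \<le> 1 * norm w" for w
    by (rule abs_linear_le_norm) (use \<phi> in auto)
  have "bounded_linear \<phi>"
    using \<phi>(1) \<phi>_abs by (intro bounded_linear_intro[of \<phi> 1]) (auto simp: linear_add linear_scale)
  then have cont: "continuous_on (cball 0 1) \<phi>"
    by (rule linear_continuous_on)
  have "\<phi> w \<le> 1" if "w \<in> cball 0 1" for w
    using \<phi>(2)[of w] that by simp
  then have bdd: "bdd_above (\<phi> ` cball 0 1)" by (rule bdd_aboveI2)
  have compl: "complete (cball (0::'a) 1)" by (simp add: complete_eq_closed)
  obtain y where y: "y \<in> cball 0 1" "k * dist x y \<le> \<phi> y - \<phi> x"
      "\<And>z. z \<in> cball 0 1 \<Longrightarrow> \<phi> z - \<phi> y \<le> k * dist y z"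
    using Ekeland[OF compl cont bdd k(1) x] by blast
  txt \<open>Sandwiching \<open>h\<close> between \<open>\<phi>\<close> on the cone of directions from \<open>y\<close> into the ball and \<open>k\<close> times
    the norm makes \<open>\<phi> - h\<close> attain its maximum over the ball at \<open>y\<close>; \<open>\<psi>\<close> is its normalisation.\<close>
  define K where "K = conic hull ((\<lambda>z. z - y) ` cball 0 1)"
  have K: "convex_cone K"
    unfolding K_def convex_cone_def
  proof (intro conjI convex_conic_hull conic_conic_hull convex_translation_subtract)
    show "conic hull ((\<lambda>z. z - y) ` cball 0 1) \<noteq> {}" by (simp add: conic_hull_eq_empty)
  qed (rule convex_cball)
  obtain h where h: "linear h" "\<And>w. h w \<le> k * norm w" "\<And>w. w \<in> K \<Longrightarrow> \<phi> w \<le> h w"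
  proof (rule Hahn_Banach_sandwich[OF sublinear_norm[of k] K, of \<phi>])
    show "\<phi> w \<le> k * norm w" if "w \<in> K" for w
    proof -
      have "\<exists>c v. w = c *\<^sub>R v \<and> c \<ge> 0 \<and> v \<in> (\<lambda>z. z - y) ` cball 0 1"
        using that unfolding K_def conic_hull_explicit by (rule CollectD)
      then obtain c z where cz: "c \<ge> 0" "z \<in> cball 0 1" "w = c *\<^sub>R (z - y)" by blast
      have "\<phi> (z - y) \<le> k * norm (z - y)"
        using y(3)[OF cz(2)] linear_diff[OF \<phi>(1)] by (simp add: dist_norm norm_minus_commute)
      then have "c * \<phi> (z - y) \<le> c * (k * norm (z - y))" using cz(1) by (rule mult_left_mono)
      then show ?thesis using cz \<phi>(1) by (simp add: linear_scale mult.left_commute)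
    qed
  qed (use k \<phi>(1) in \<open>simp_all add: linear_add linear_scale\<close>)
  \<comment> \<open>The maximum of \<open>\<phi> - h\<close> over the ball, hence its dual norm. The
    bound \<open>k \<le> 1/2\<close> keeps it positive and within \<open>2 * k\<close> of 1.\<close>
  define s where "s = \<phi> y - h y"
  have supp: "\<phi> z - h z \<le> s" if "norm z \<le> 1" for z
  proof -
    have "z - y \<in> K" unfolding K_def using that by (intro hull_inc) auto
    then show ?thesis using h(3)[of "z - y"] linear_diff[OF \<phi>(1)] linear_diff[OF h(1)]
      by (simp add: s_def)
  qed
  have h_abs: "\<bar>h w\<bar> \<le> k * norm w" for w by (rule abs_linear_le_norm[OF h(1,2)])
  have nx: "norm x \<le> 1" and ny: "norm y \<le> 1" using x y by auto
  have hk: "\<bar>h w\<bar> \<le> k" if "norm w \<le> 1" for w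
    using h_abs[of w] mult_left_mono[OF that, of k] k by linarith
  have k2: "k\<^sup>2 \<le> k * (1/2)" unfolding power2_eq_square using k by (intro mult_left_mono) auto
  have s_lo: "1 - k\<^sup>2 - k \<le> s" using supp[OF nx] hk[OF nx] \<phi>x by linarith
  have s_hi: "s \<le> 1 + k" using hk[OF ny] \<phi>(2)[of y] ny by (simp add: s_def)
  have s: "s > 0" using s_lo k2 k by linarith
  have \<chi>_le: "\<phi> w - h w \<le> s * norm w" for w
  proof (cases "w = 0")
    case True
    then show ?thesis using linear_0[OF \<phi>(1)] linear_0[OF h(1)] by simp
  next
    case False
    have "\<phi> (inverse (norm w) *\<^sub>R w) - h (inverse (norm w) *\<^sub>R w) \<le> s"
      by (rule supp) (use False in simp)
    then have "inverse (norm w) * (\<phi> w - h w) \<le> s"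
      using \<phi>(1) h(1) by (simp add: linear_scale right_diff_distrib)
    then show ?thesis using False by (simp add: field_simps)
  qed
  define \<psi> where "\<psi> w = (\<phi> w - h w) / s" for w
  have \<psi>_lin: "linear \<psi>"
    unfolding \<psi>_def using \<phi>(1) h(1)
    by (intro linearI) (simp_all add: linear_add linear_scale diff_divide_distrib add_divide_distrib algebra_simps)
  have \<psi>_le: "\<psi> w \<le> norm w" for w
    using \<chi>_le[of w] s by (simp add: \<psi>_def field_simps)
  have \<psi>y: "\<psi> y = 1" using s by (simp add: \<psi>_def s_def)
  have "norm y = 1" using \<psi>_le[of y] \<psi>y ny by simp
  moreover have "dist x y \<le> k"
  proof -
    have "k * dist x y \<le> k * k"
      using y(2) \<phi>(2)[of y] ny \<phi>x by (simp add: power2_eq_square)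
    then show ?thesis using k by simp
  qed
  moreover have "\<bar>\<phi> w - \<psi> w\<bar> \<le> 3 * k * norm w" for w
  proof -
    \<comment> \<open>The two summands contribute \<open>k\<close> and \<open>2 * k\<close> to the
      constant \<open>3 * k\<close>.\<close>
    have "\<phi> w - \<psi> w = h w + (s - 1) * \<psi> w" using s by (simp add: \<psi>_def field_simps)
    moreover have "\<bar>(s - 1) * \<psi> w\<bar> \<le> 2 * k * norm w"
      unfolding abs_mult
    proof (rule mult_mono)
      show "\<bar>s - 1\<bar> \<le> 2 * k" using s_lo s_hi k2 k by linarith
      show "\<bar>\<psi> w\<bar> \<le> norm w"
        using abs_linear_le_norm[OF \<psi>_lin, of 1 w] \<psi>_le by simp
    qed (use k in auto)
    ultimately show ?thesis using h_abs[of w] by linarith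
  qed
  ultimately show thesis using \<psi>_lin \<psi>_le \<psi>y by (intro that)
qed

section \<open>Complex functionals\<close>

lemma bounded_linear_scaleC: "bounded_linear (\<lambda>x::'a::complex_normed_vector. c *\<^sub>C x)"
  by (rule bounded_linear_intro[of _ "cmod c"])
    (auto simp: scaleC_add_right scaleR_scaleC scaleC_scaleC norm_scaleC mult.commute)

text \<open>A complex-linear functional is determined by its real part through \<open>G\<close>. A
  rotation of the argument makes the value real and nonnegative, so the bound on the real part
  bounds the modulus.\<close>

lemma complexify_functional:
  fixes \<phi> :: "'a::complex_normed_vector \<Rightarrow> real"
  assumes \<phi>: "linear \<phi>" "\<And>x. \<phi> x \<le> norm x"
  obtains \<Phi> where "\<Phi> \<in> cdual" "norm \<Phi> \<le> 1" "\<And>x. Re (blinfun_apply \<Phi> x) = \<phi> x"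
proof -
  define G where "G x = Complex (\<phi> x) (- \<phi> (\<i> *\<^sub>C x))" for x
  have G_add: "G (x + y) = G x + G y" for x y
    using \<phi>(1) by (simp add: G_def complex_eq_iff scaleC_add_right linear_add)
  have G_scaleR: "G (r *\<^sub>R x) = of_real r * G x" for r x
  proof -
    have "\<i> *\<^sub>C r *\<^sub>R x = r *\<^sub>R \<i> *\<^sub>C x"
      by (simp add: scaleR_scaleC scaleC_scaleC mult.commute)
    then show ?thesis using \<phi>(1) by (simp add: G_def complex_eq_iff linear_scale)
  qed
  have G_i: "G (\<i> *\<^sub>C x) = \<i> * G x" for x
  proof -
    have "\<i> *\<^sub>C \<i> *\<^sub>C x = (- 1) *\<^sub>R x" by (simp add: scaleR_scaleC scaleC_scaleC)
    then show ?thesis using \<phi>(1) by (simp add: G_def complex_eq_iff linear_neg)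
  qed
  have G_scaleC: "G (c *\<^sub>C x) = c * G x" for c x
  proof -
    have "c *\<^sub>C x = Re c *\<^sub>R x + Im c *\<^sub>R \<i> *\<^sub>C x"
      by (simp add: scaleR_scaleC scaleC_scaleC scaleC_add_left[symmetric] complex_eq[symmetric] mult.commute)
    also have "G \<dots> = (of_real (Re c) + \<i> * of_real (Im c)) * G x"
      by (simp only: G_add G_scaleR G_i) (simp add: algebra_simps)
    finally show ?thesis by (simp only: complex_eq[symmetric])
  qed
  have G_norm: "norm (G x) \<le> norm x" for x
  proof -
    \<comment> \<open>If \<open>G x = 0\<close> then \<open>u = 0\<close>, so \<open>u\<close> has
      modulus at most 1 rather than exactly 1.\<close>
    define u where "u = cnj (sgn (G x))"
    have u: "cmod u \<le> 1" by (simp add: u_def norm_sgn)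
    have "u * G x = of_real (norm (G x))"
      using complex_norm_square[of "G x"]
      by (cases "G x = 0") (simp_all add: u_def sgn_div_norm scaleR_conv_of_real
          mult.commute[of "cnj _"] field_simps power2_eq_square)
    then have "norm (G x) = Re (G (u *\<^sub>C x))" by (simp add: G_scaleC)
    also have "\<dots> \<le> norm (u *\<^sub>C x)" using \<phi>(2) by (simp add: G_def)
    also have "\<dots> \<le> norm x" using mult_right_mono[OF u, of "norm x"] by (simp add: norm_scaleC)
    finally show ?thesis .
  qed
  have bl: "bounded_linear G"
    using G_norm by (intro bounded_linear_intro[of _ 1]) (auto simp: G_add G_scaleR scaleR_conv_of_real)
  have app: "blinfun_apply (Blinfun G) = G" by (rule bounded_linear_Blinfun_apply[OF bl])
  show thesis
  proof (rule that[of "Blinfun G"])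
    show "norm (Blinfun G) \<le> 1" by (rule norm_blinfun_bound) (simp_all add: app G_norm)
    show "Blinfun G \<in> cdual" by (simp add: cdual_def app G_scaleC)
    show "Re (blinfun_apply (Blinfun G) x) = \<phi> x" for x by (simp add: app G_def)
  qed
qed

text \<open>A complex number of modulus at most 1 with real part 1 equals 1.\<close>

lemma complexify_support_functional:
  fixes \<phi> :: "'a::complex_normed_vector \<Rightarrow> real"
  assumes "linear \<phi>" "\<And>x. \<phi> x \<le> norm x" "norm y = 1" "\<phi> y = 1"
  obtains \<Phi> where "\<Phi> \<in> cdual" "norm \<Phi> = 1" "blinfun_apply \<Phi> y = 1"
    "\<And>x. Re (blinfun_apply \<Phi> x) = \<phi> x"
proof -
  obtain \<Phi> where \<Phi>: "\<Phi> \<in> cdual" "norm \<Phi> \<le> 1" "\<And>x. Re (blinfun_apply \<Phi> x) = \<phi> x"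
    using complexify_functional[OF assms(1,2)] by blast
  have le: "cmod (blinfun_apply \<Phi> y) \<le> norm \<Phi>"
    using norm_blinfun[of \<Phi> y] assms(3) by simp
  have re: "Re (blinfun_apply \<Phi> y) = 1" using \<Phi>(3) assms(4) by simp
  have "norm \<Phi> = 1" using complex_Re_le_cmod[of "blinfun_apply \<Phi> y"] le re \<Phi>(2) by linarith
  moreover have "Im (blinfun_apply \<Phi> y) = 0"
  proof -
    have "(cmod (blinfun_apply \<Phi> y))\<^sup>2 \<le> 1\<^sup>2" using le \<Phi>(2) by (intro power_mono) auto
    then show ?thesis using re by (simp add: cmod_power2)
  qed
  then have "blinfun_apply \<Phi> y = 1" using re by (simp add: complex_eq_iff)
  ultimately show thesis using \<Phi> that by blast
qed

section \<open>Numerical range and parallelism with the identity\<close>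

text \<open>Complex values are kept instead of moduli because their arguments determine the scalar
  in the parallelism.\<close>

definition numerical_range :: "('a::complex_normed_vector \<Rightarrow> 'a) \<Rightarrow> complex set"
  where "numerical_range f = {blinfun_apply \<phi> (f x) | x \<phi>.
    x \<in> sphere 0 1 \<and> \<phi> \<in> cdual \<and> norm \<phi> = 1 \<and> blinfun_apply \<phi> x = 1}"

lemma numerical_radius_eq:
  "numerical_radius f = (if numerical_range f = {} then 0 else (SUP c\<in>numerical_range f. cmod c))"
proof -
  have "{cmod (blinfun_apply \<phi> (f x)) | x \<phi>.
      x \<in> sphere 0 1 \<and> \<phi> \<in> cdual \<and> norm \<phi> = 1 \<and> blinfun_apply \<phi> x = 1} = cmod ` numerical_range f"
    unfolding numerical_range_def by blast
  then show ?thesis unfolding numerical_radius_def by simp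
qed

lemma numerical_range_nonempty:
  fixes a :: "'a::complex_normed_vector"
  assumes "a \<noteq> 0"
  shows "numerical_range (f :: 'a \<Rightarrow> 'a) \<noteq> {}"
proof -
  define y where "y = inverse (norm a) *\<^sub>R a"
  have y: "norm y = 1" using assms by (simp add: y_def)
  obtain h where h: "linear h" "\<And>x. h x \<le> norm x" "h y = norm y"
    using norming_functional by blast
  obtain \<Phi> where "\<Phi> \<in> cdual" "norm \<Phi> = 1" "blinfun_apply \<Phi> y = 1"
    using complexify_support_functional[OF h(1,2) y] h(3) y by metis
  then show ?thesis using y by (auto simp: numerical_range_def)
qed

section \<open>The supremum norm and bounds on the numerical range\<close>

lemma norm_le_Cu_norm:
  assumes "f \<in> Cu" "norm x \<le> 1"
  shows "norm (f x) \<le> Cu_norm f"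
  unfolding Cu_norm_def
proof (rule cSUP_upper)
  show "bdd_above ((\<lambda>x. norm (f x)) ` cball 0 1)"
    using Cu_bounded[OF assms(1)] by (auto simp: bounded_iff intro: bdd_aboveI2)
qed (use assms(2) in simp)

lemma Cu_norm_le:
  assumes "\<And>x. norm x \<le> 1 \<Longrightarrow> norm (f x) \<le> m"
  shows "Cu_norm f \<le> m"
  unfolding Cu_norm_def by (rule cSUP_least) (use assms in auto)

lemma less_Cu_normE:
  assumes "m < Cu_norm f"
  obtains x where "norm x \<le> 1" "m < norm (f x)"
  using assms Cu_norm_le[of f m] by (meson not_less)

lemma Cu_norm_id:
  fixes a :: "'a::complex_normed_vector"
  assumes "a \<noteq> 0"
  shows "Cu_norm (\<lambda>x::'a. x) = 1"
proof (rule antisym)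
  show "Cu_norm (\<lambda>x::'a. x) \<le> 1" by (rule Cu_norm_le)
  have "(\<lambda>x::'a. x) \<in> Cu" by (simp add: Cu_def uniformly_continuous_on_id)
  from norm_le_Cu_norm[OF this, of "inverse (norm a) *\<^sub>R a"]
  show "1 \<le> Cu_norm (\<lambda>x::'a. x)" using assms by simp
qed

lemma Cu_add_scaleC_id: "f \<in> Cu \<Longrightarrow> (\<lambda>x. f x + \<mu> *\<^sub>C x) \<in> Cu"
  unfolding Cu_def
  by (auto intro!: uniformly_continuous_on_add uniformly_continuous_on_id
      bounded_linear.uniformly_continuous_on[OF bounded_linear_scaleC])

lemma numerical_range_norm_le:
  assumes "f \<in> Cu" "c \<in> numerical_range f"
  shows "cmod c \<le> Cu_norm f"
proof -
  obtain x \<phi> where x: "norm x = 1" "norm \<phi> = 1" "c = blinfun_apply \<phi> (f x)"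
    using assms(2) by (auto simp: numerical_range_def)
  have "cmod c \<le> norm (f x)" using norm_blinfun[of \<phi> "f x"] x by simp
  also have "\<dots> \<le> Cu_norm f" using assms(1) x by (intro norm_le_Cu_norm) auto
  finally show ?thesis .
qed

lemma numerical_range_add_scaleC_id:
  assumes "c \<in> numerical_range f"
  shows "c + \<mu> \<in> numerical_range (\<lambda>x. f x + \<mu> *\<^sub>C x)"
proof -
  obtain x \<phi> where x: "x \<in> sphere 0 1" "\<phi> \<in> cdual" "norm \<phi> = 1" "blinfun_apply \<phi> x = 1"
      and c: "c = blinfun_apply \<phi> (f x)"
    using assms unfolding numerical_range_def by blast
  have "c + \<mu> = blinfun_apply \<phi> (f x + \<mu> *\<^sub>C x)"
    using x(2,4) by (simp add: c cdual_def blinfun.add_right)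
  then show ?thesis unfolding numerical_range_def using x by blast
qed

text \<open>The numerical radius may not be attained, but the closure of the numerical range is
  compact and contains a \<open>z\<close> of maximal modulus. With \<open>\<mu>\<close> in the
  direction of \<open>z\<close>, the moduli of \<open>z\<close> and \<open>\<mu>\<close> add
  up.\<close>

lemma numerical_radius_imp_parallel:
  fixes f :: "'a::complex_normed_vector \<Rightarrow> 'a"
  assumes f: "f \<in> Cu" and a: "a \<noteq> (0::'a)" and eq: "numerical_radius f = Cu_norm f"
  shows "f \<parallel>\<^sub>u (\<lambda>x. x)"
proof -
  let ?C = "closure (numerical_range f)"
  have ne: "numerical_range f \<noteq> {}" by (rule numerical_range_nonempty[OF a])
  have bdd: "bounded (numerical_range f)"
    using numerical_range_norm_le[OF f] by (auto simp: bounded_iff)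
  have "compact ?C" using bdd by simp
  then obtain z where z: "z \<in> ?C" "\<And>c. c \<in> ?C \<Longrightarrow> cmod c \<le> cmod z"
    using continuous_attains_sup[of ?C cmod] ne continuous_on_norm_id by auto
  have "Cu_norm f \<le> cmod z"
    unfolding eq[symmetric] numerical_radius_eq using ne z(2) closure_subset
    by (auto intro!: cSUP_least)
  obtain \<mu> where \<mu>: "cmod \<mu> = 1" "z = of_real (cmod z) * \<mu>"
  proof (cases "z = 0")
    case True
    then show thesis using that[of 1] by simp
  next
    case False
    then show thesis
      using that[of "sgn z"] norm_sgn[of z] by (simp add: sgn_div_norm scaleR_conv_of_real)
  qed
  let ?g = "\<lambda>x. f x + \<mu> *\<^sub>C x"
  have g: "?g \<in> Cu" by (rule Cu_add_scaleC_id[OF f])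
  \<comment> \<open>The estimate is a closed condition on \<open>c\<close>, so it passes to the
    closure and hence to \<open>z\<close>.\<close>
  have "numerical_range f \<subseteq> {c. cmod (c + \<mu>) \<le> Cu_norm ?g}"
    using numerical_range_norm_le[OF g] numerical_range_add_scaleC_id by blast
  moreover have "closed {c. cmod (c + \<mu>) \<le> Cu_norm ?g}"
    by (intro closed_Collect_le continuous_intros)
  ultimately have "cmod (z + \<mu>) \<le> Cu_norm ?g"
    using z(1) closure_minimal by blast
  moreover have "cmod (z + \<mu>) = cmod z + 1"
  proof -
    have "z + \<mu> = of_real (cmod z + 1) * \<mu>" using \<mu>(2) by (simp add: algebra_simps)
    then have "cmod (z + \<mu>) = \<bar>cmod z + 1\<bar>"
      using \<mu>(1) by (simp only: norm_mult norm_of_real mult_1_right)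
    then show ?thesis by simp
  qed
  moreover have "Cu_norm ?g \<le> Cu_norm f + 1"
  proof (rule Cu_norm_le)
    fix x :: 'a assume x: "norm x \<le> 1"
    have "norm (f x + \<mu> *\<^sub>C x) \<le> norm (f x) + norm (\<mu> *\<^sub>C x)" by (rule norm_triangle_ineq)
    then show "norm (f x + \<mu> *\<^sub>C x) \<le> Cu_norm f + 1"
      using norm_le_Cu_norm[OF f x] x \<mu>(1) by (simp add: norm_scaleC)
  qed
  ultimately have "Cu_norm ?g = Cu_norm f + Cu_norm (\<lambda>x::'a. x)"
    using \<open>Cu_norm f \<le> cmod z\<close> Cu_norm_id[OF a] by linarith
  then show ?thesis unfolding Cu_parallel_def using \<mu>(1) by auto
qed

lemma parallel_imp_numerical_range_ge:
  fixes f :: "'a::complex_banach \<Rightarrow> 'a"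
  assumes f: "f \<in> Cu" and a: "a \<noteq> (0::'a)" and par: "f \<parallel>\<^sub>u (\<lambda>x. x)" and e: "e > 0"
  obtains c where "c \<in> numerical_range f" "Cu_norm f - e \<le> cmod c"
proof -
  define M where "M = Cu_norm f"
  obtain \<mu> where \<mu>: "cmod \<mu> = 1" and eq: "Cu_norm (\<lambda>x. f x + \<mu> *\<^sub>C x) = M + 1"
    using par Cu_norm_id[OF a] by (auto simp: Cu_parallel_def M_def)
  \<comment> \<open>Rotating by \<open>cnj \<mu>\<close> replaces \<open>f + \<mu> Id\<close> by
    \<open>g + Id\<close> without changing norms.\<close>
  define g where "g x = cnj \<mu> *\<^sub>C f x" for x
  have norm_g: "norm (g x) = norm (f x)" for x by (simp add: g_def norm_scaleC \<mu>)
  have g_le: "norm (g x) \<le> M" if "norm x \<le> 1" for x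
    using norm_le_Cu_norm[OF f that] by (simp add: norm_g M_def)
  have M: "M \<ge> 0" using g_le[of 0] norm_ge_zero[of "g 0"] by (simp del: norm_ge_zero)
  have "uniformly_continuous_on (cball 0 1) f" using f by (simp add: Cu_def)
  then obtain d where d: "d > 0"
    "\<And>x y. norm x \<le> 1 \<Longrightarrow> norm y \<le> 1 \<Longrightarrow> dist y x < d \<Longrightarrow> dist (f y) (f x) < e / 2"
    unfolding uniformly_continuous_on_def using e by (metis half_gt_zero mem_cball_0)
  \<comment> \<open>The three bounds serve the Bishop-Phelps-Bollobas theorem, the uniform
    continuity of \<open>f\<close>, and the budget \<open>k + 3 * k * M \<le> e / 2\<close>. The
    other half of \<open>e\<close> pays for moving from \<open>g x\<close> to
    \<open>g y\<close>.\<close>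
  define k where "k = min (1/2) (min (d/2) (e / (2 * (1 + 3 * M))))"
  have "k \<le> 1/2" unfolding k_def by (rule min.cobounded1)
  moreover have "0 < k" "k < d" using d(1) e M by (auto simp: k_def min_less_iff_disj)
  ultimately have k: "0 < k" "k \<le> 1/2" "k < d" by auto
  have "k \<le> e / (2 * (1 + 3 * M))" by (simp add: k_def)
  then have kM: "k + 3 * k * M \<le> e / 2" using M by (simp add: field_simps)
  have k2: "0 < k\<^sup>2" "k\<^sup>2 \<le> k" using k by (simp_all add: power2_eq_square)
  obtain x where x: "norm x \<le> 1" "M + 1 - k\<^sup>2 < norm (f x + \<mu> *\<^sub>C x)"
    using less_Cu_normE[of "M + 1 - k\<^sup>2" "\<lambda>x. f x + \<mu> *\<^sub>C x"] eq k2 by auto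
  have "g x + x = cnj \<mu> *\<^sub>C (f x + \<mu> *\<^sub>C x)"
    using \<mu> by (simp add: g_def scaleC_add_right scaleC_scaleC scaleC_one
        mult.commute[of "cnj _"] complex_norm_square[symmetric])
  then have x': "M + 1 - k\<^sup>2 < norm (g x + x)" using x(2) \<mu> by (simp add: norm_scaleC)
  obtain \<phi> where \<phi>: "linear \<phi>" "\<And>w. \<phi> w \<le> norm w" "\<phi> (g x + x) = norm (g x + x)"
    using norming_functional by blast
  \<comment> \<open>The summands are at most \<open>M\<close> and 1, so each is within
    \<open>k\<^sup>2\<close> of its bound.\<close>
  have sum: "M + 1 - k\<^sup>2 < \<phi> (g x) + \<phi> x" using x' \<phi> by (simp add: linear_add)
  have \<phi>x: "1 - k\<^sup>2 \<le> \<phi> x" using sum \<phi>(2)[of "g x"] g_le[OF x(1)] by linarith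
  have \<phi>g: "M - k\<^sup>2 \<le> \<phi> (g x)" using sum \<phi>(2)[of x] x(1) by linarith
  obtain y \<psi> where y: "norm y = 1" and \<psi>: "linear \<psi>" "\<And>w. \<psi> w \<le> norm w" "\<psi> y = 1"
    and xy: "dist x y \<le> k" and close: "\<And>w. \<bar>\<phi> w - \<psi> w\<bar> \<le> 3 * k * norm w"
    using Bishop_Phelps_Bollobas[OF _ \<phi>(1,2) k(1,2) \<phi>x] x(1) by (metis mem_cball_0)
  have "norm (g x - g y) = norm (f x - f y)"
  proof -
    have "g x - g y = cnj \<mu> *\<^sub>C (f x - f y)"
      unfolding g_def by (simp add: linear_diff bounded_linear.linear bounded_linear_scaleC)
    then show ?thesis using \<mu> by (simp add: norm_scaleC)
  qed
  also have "\<dots> < e / 2"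
    using d(2)[of y x] x(1) y xy k(3) by (simp add: dist_norm)
  finally have gxy: "\<phi> (g x) - \<phi> (g y) < e / 2"
    using \<phi>(2)[of "g x - g y"] linear_diff[OF \<phi>(1), of "g x" "g y"] by linarith
  have "3 * k * norm (g y) \<le> 3 * k * M"
    using g_le[of y] y k by (intro mult_left_mono) auto
  then have "M - e \<le> \<psi> (g y)"
    using gxy \<phi>g close[of "g y"] k2 kM by linarith
  obtain \<Psi> where \<Psi>: "\<Psi> \<in> cdual" "norm \<Psi> = 1" "blinfun_apply \<Psi> y = 1"
      "\<And>w. Re (blinfun_apply \<Psi> w) = \<psi> w"
    using complexify_support_functional[OF \<psi>(1,2) y \<psi>(3)] by blast
  have "\<psi> (g y) \<le> cmod (blinfun_apply \<Psi> (g y))"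
    using complex_Re_le_cmod[of "blinfun_apply \<Psi> (g y)"] \<Psi>(4) by simp
  also have "\<dots> = cmod (blinfun_apply \<Psi> (f y))"
    using \<Psi>(1) \<mu> by (simp add: g_def cdual_def norm_mult)
  finally have "Cu_norm f - e \<le> cmod (blinfun_apply \<Psi> (f y))"
    using \<open>M - e \<le> \<psi> (g y)\<close> by (simp add: M_def)
  then show thesis using that \<Psi> y by (auto simp: numerical_range_def)
qed

lemma parallel_imp_numerical_radius:
  fixes f :: "'a::complex_banach \<Rightarrow> 'a"
  assumes f: "f \<in> Cu" and a: "a \<noteq> (0::'a)" and par: "f \<parallel>\<^sub>u (\<lambda>x. x)"
  shows "numerical_radius f = Cu_norm f"
proof -
  have ne: "numerical_range f \<noteq> {}" by (rule numerical_range_nonempty[OF a])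
  have bdd: "bdd_above (cmod ` numerical_range f)"
    using numerical_range_norm_le[OF f] by (rule bdd_aboveI2)
  have "Cu_norm f \<le> (SUP c\<in>numerical_range f. cmod c) + e" if "e > 0" for e
  proof -
    obtain c where "c \<in> numerical_range f" "Cu_norm f - e \<le> cmod c"
      using parallel_imp_numerical_range_ge[OF f a par \<open>e > 0\<close>] by blast
    then show ?thesis using cSUP_upper[OF _ bdd, of c] by linarith
  qed
  then have "Cu_norm f \<le> (SUP c\<in>numerical_range f. cmod c)" by (rule field_le_epsilon)
  moreover have "(SUP c\<in>numerical_range f. cmod c) \<le> Cu_norm f"
    using ne numerical_range_norm_le[OF f] by (rule cSUP_least)
  ultimately show ?thesis using ne by (simp add: numerical_radius_eq)
qed

theorem theorem2p8:
  fixes f :: "'a::complex_banach \<Rightarrow> 'a"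
  assumes "f \<in> Cu"
  shows "numerical_radius f = Cu_norm f \<longleftrightarrow> f \<parallel>\<^sub>u (\<lambda>x. x)"
proof (cases "\<exists>a::'a. a \<noteq> 0")
  case True
  then show ?thesis
    using numerical_radius_imp_parallel parallel_imp_numerical_radius assms by blast
next
  case False
  \<comment> \<open>In the zero space the sphere is empty, so the numerical radius takes its default
    value 0. All supremum norms vanish, that of the identity included, and both sides of the
    equivalence hold.\<close>
  then have zero: "x = 0" for x :: 'a by blast
  have norm0: "Cu_norm h = 0" for h :: "'a \<Rightarrow> 'a"
  proof -
    have "norm (h x) = 0" for x using zero[of "h x"] by simp
    then show ?thesis by (simp add: Cu_norm_def)
  qed
  have "norm x \<noteq> 1" for x :: 'a using zero[of x] by simp
  then have "numerical_range f = {}" by (simp add: numerical_range_def)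
  then have "numerical_radius f = 0" by (simp add: numerical_radius_eq)
  moreover have "f \<parallel>\<^sub>u (\<lambda>x. x)"
    unfolding Cu_parallel_def norm0 by (intro bexI[of _ 1]) auto
  ultimately show ?thesis by (simp add: norm0)
qed

end
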